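(* Let $X$ be a Banach space whose dual $X^*$ has infratype $p>1$ with constant $I_p(X^* )$. Then, for every $k\in\mathbb N$, $$\operatorname{Helly}_X(k)\le\frac{3}{1-2^{-1+\frac1p}}\,I_p(X^* )\,k^{-1+\frac1p}.$$
   Context: A Banach space $E$ has infratype $p\in[1,2]$ if there is a constant $I<\infty$ such that for every finite sequence $u_1,\dots,u_m\in E$, $\min_{\theta_i=\pm1}\|\sum_{i=1}^m\theta_i u_i\|\le I\left(\sum_{i=1}^m\|u_i\|^p\right)^{1/p}$; $I_p(E)$ is the least such constant. $\mathbf B_X$ is the closed unit ball of $X$. $\operatorname{Helly}_X(k)$ is the infimum of all $\alpha>0$ such that: for every finite family $\mathcal F$ of convex subsets of $\mathbf B_X$, if every subfamily of $\mathcal F$ of size at most $k$ has non-empty intersection, then there is $x\in X$ with $\operatorname{dist}(x,C)\le\alpha$ for every $C\in\mathcal F$. *)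

theory Defs
  imports "HOL-Analysis.Analysis"
begin

text \<open>
  Spaces are passed as type arguments: \<open>infratype_const TYPE('e) p\<close> is \<open>I\<^sub>p(E)\<close>.
  The dual of \<open>'a\<close> is the library type \<open>'a \<Rightarrow>\<^sub>L real\<close> with its operator norm.
\<close>

text \<open>
  The condition \<open>0 \<le> I\<close> only matters for the zero space, where every real \<open>I\<close> satisfies the
  inequality; it makes the least constant equal to \<open>0\<close> there.
\<close>

definition infratype_bound :: "'e::real_normed_vector itself \<Rightarrow> real \<Rightarrow> real \<Rightarrow> bool"
  where "infratype_bound _ p I \<longleftrightarrow>
    0 \<le> I \<and>
    (\<forall>(m::nat) (u :: nat \<Rightarrow> 'e).
      (MIN \<theta> \<in> {..<m} \<rightarrow>\<^sub>E {-1, 1::real}. norm (\<Sum>i<m. \<theta> i *\<^sub>R u i))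
        \<le> I * (\<Sum>i<m. norm (u i) powr p) powr (1 / p))"

definition has_infratype :: "'e::real_normed_vector itself \<Rightarrow> real \<Rightarrow> bool"
  where "has_infratype E p \<longleftrightarrow> 1 \<le> p \<and> p \<le> 2 \<and> (\<exists>I. infratype_bound E p I)"

definition infratype_const :: "'e::real_normed_vector itself \<Rightarrow> real \<Rightarrow> real"
  where "infratype_const E p = Inf {I. infratype_bound E p I}"

text \<open>The infimum is attained, so it is the least constant.\<close>

lemma infratype_bound_infratype_const:
  assumes "has_infratype (E :: 'e::real_normed_vector itself) p"
  shows "infratype_bound E p (infratype_const E p)"
proof -
  let ?S = "{I. infratype_bound E p I}"
  have ne: "?S \<noteq> {}"
    using assms by (auto simp: has_infratype_def)
  have nonneg: "0 \<le> Inf ?S"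
    using ne by (intro cInf_greatest) (auto simp: infratype_bound_def)
  have "(MIN \<theta> \<in> {..<m} \<rightarrow>\<^sub>E {-1, 1::real}. norm (\<Sum>i<m. \<theta> i *\<^sub>R u i))
        \<le> Inf ?S * (\<Sum>i<m. norm (u i) powr p) powr (1 / p)" (is "?L \<le> _ * ?R")
    for m :: nat and u :: "nat \<Rightarrow> 'e"
  proof (cases "?R = 0")
    case True
    obtain I where "infratype_bound E p I"
      using ne by auto
    then have "?L \<le> I * ?R"
      unfolding infratype_bound_def by blast
    then show ?thesis
      unfolding True by simp
  next
    case False
    then have pos: "0 < ?R"
      by (metis powr_ge_zero order_le_less)
    have "?L / ?R \<le> Inf ?S"
    proof (rule cInf_greatest[OF ne])
      fix I assume "I \<in> ?S"
      then have "?L \<le> I * ?R"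
        unfolding infratype_bound_def by blast
      then show "?L / ?R \<le> I"
        using pos by (simp only: pos_divide_le_eq)
    qed
    then show ?thesis
      using pos by (simp only: pos_divide_le_eq)
  qed
  with nonneg show ?thesis
    unfolding infratype_const_def infratype_bound_def[of E p "Inf _"] by blast
qed

text \<open>
  Repetitions in a family are irrelevant here, so a finite family is a finite set of sets.
  The library has \<open>infdist x {} = 0\<close>, unlike the convention \<open>dist(x, {}) = \<infinity>\<close>. For \<open>k \<ge> 1\<close> this
  makes no difference, since the one-element subfamilies force every member to be non-empty;
  for \<open>k = 0\<close> the value is not meaningful.
\<close>

definition helly_admissible :: "'a::real_normed_vector itself \<Rightarrow> nat \<Rightarrow> real \<Rightarrow> bool"
  where "helly_admissible _ k \<alpha> \<longleftrightarrow>
    (\<forall>\<F> :: 'a set set.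
      finite \<F> \<longrightarrow>
      (\<forall>C\<in>\<F>. convex C \<and> C \<subseteq> cball 0 1) \<longrightarrow>
      (\<forall>\<G>. \<G> \<subseteq> \<F> \<and> card \<G> \<le> k \<longrightarrow> \<Inter>\<G> \<noteq> {}) \<longrightarrow>
      (\<exists>x. \<forall>C\<in>\<F>. infdist x C \<le> \<alpha>))"

definition helly :: "'a::real_normed_vector itself \<Rightarrow> nat \<Rightarrow> real"
  where "helly X k = Inf {\<alpha>. 0 < \<alpha> \<and> helly_admissible X k \<alpha>}"

text \<open>For \<open>k \<ge> 1\<close> the infimum ranges over a non-empty set: take \<open>x = 0\<close>.\<close>

lemma helly_admissible_1:
  assumes "1 \<le> k"
  shows "helly_admissible (X :: 'a::real_normed_vector itself) k 1"
  unfolding helly_admissible_def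
proof (intro allI impI exI[of _ 0] ballI)
  fix \<F> :: "'a set set" and C
  assume sub: "\<forall>C\<in>\<F>. convex C \<and> C \<subseteq> cball 0 1"
    and inter: "\<forall>\<G>. \<G> \<subseteq> \<F> \<and> card \<G> \<le> k \<longrightarrow> \<Inter>\<G> \<noteq> {}"
    and C: "C \<in> \<F>"
  have "\<Inter>{C} \<noteq> {}"
    using inter[rule_format, of "{C}"] C assms by simp
  then obtain c where c: "c \<in> C"
    by auto
  then have "dist 0 c \<le> 1"
    using sub C by (meson mem_cball subsetD)
  with c show "infdist 0 C \<le> 1"
    by (rule infdist_le2)
qed

end

(*
If no point is within b of every member of the family, Hahn-Banach in the power X^F gives functionals
f_C with sum f_C = 0, sum |f_C| <= 1 and sum inf_C f_C >= b. Replace them by N = k 2^m normalised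
functionals, almost uniformly weighted, whose mean is nearly 0 while the mean h of their lower bounds
is nearly b. Pair them up and choose one from each pair: infratype of the dual, applied to the
differences within the pairs, yields a choice moving the mean by at most I n^(-1+1/p) for n pairs, and
so does the complementary choice, so one of the two does not decrease h. After m halvings k functionals
are left; a common point of their k sets bounds b by the norm of their mean, and the errors form a
geometric series.
*)
theory Submission
  imports Defs "HOL-Library.Function_Algebras"
begin

section \<open>Hahn--Banach and Mazur--Orlicz theorems\<close>

text \<open>Together with pointwise addition this makes families of points, one for each member of
  the given finite family of sets, into vectors, so that Hahn-Banach arguments apply to the power of
  the space.\<close>

instantiation "fun" :: (type, scaleR) scaleR
begin

definition scaleR_fun_def: "c *\<^sub>R f = (\<lambda>x. c *\<^sub>R f x)"

instance ..

end

lemma scaleR_fun_apply [simp]: "(c *\<^sub>R f) x = c *\<^sub>R f x"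
  by (simp add: scaleR_fun_def)

instance "fun" :: (type, real_vector) real_vector
  by standard (simp_all add: fun_eq_iff algebra_simps)

section \<open>Sublinear functionals and their minorants\<close>

definition sublinear :: "('v::real_vector \<Rightarrow> real) \<Rightarrow> bool"
  where "sublinear q \<longleftrightarrow>
    (\<forall>x y. q (x + y) \<le> q x + q y) \<and> (\<forall>c x. 0 \<le> c \<longrightarrow> q (c *\<^sub>R x) = c * q x)"

lemma sublinearD:
  assumes "sublinear q"
  shows sublinear_add: "q (x + y) \<le> q x + q y"
    and sublinear_scaleR: "0 \<le> c \<Longrightarrow> q (c *\<^sub>R x) = c * q x"
    and sublinear_zero: "q 0 = 0"
    and sublinear_minus: "- q (- x) \<le> q x"
proof -
  show add: "q (x + y) \<le> q x + q y" for x y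
    using assms by (simp add: sublinear_def)
  show "0 \<le> c \<Longrightarrow> q (c *\<^sub>R x) = c * q x" for c x
    using assms by (simp add: sublinear_def)
  from this[of 0] show zero: "q 0 = 0"
    by simp
  show "- q (- x) \<le> q x"
    using add[of x "- x"] zero by simp
qed

text \<open>One inequality is enough for positive homogeneity: used with \<open>inverse c\<close> at
  \<open>c *\<^sub>R x\<close> it gives the reverse one.\<close>

lemma sublinearI:
  assumes "\<And>x y. q (x + y) \<le> q x + q y"
    and zero: "q 0 = 0"
    and le: "\<And>c x. 0 < c \<Longrightarrow> q (c *\<^sub>R x) \<le> c * q x"
  shows "sublinear q"
proof -
  have "q (c *\<^sub>R x) = c * q x" if "0 \<le> c" for c x
  proof (cases "c = 0")
    case True
    then show ?thesis
      using zero by simp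
  next
    case False
    with that have c: "0 < c"
      by simp
    have "q (inverse c *\<^sub>R c *\<^sub>R x) \<le> inverse c * q (c *\<^sub>R x)"
      using c by (intro le) simp
    then have "c * q x \<le> q (c *\<^sub>R x)"
      using c by (simp add: field_simps)
    with le[OF c, of x] show ?thesis
      by simp
  qed
  with assms(1) show ?thesis
    by (simp add: sublinear_def)
qed

text \<open>For odd \<open>q\<close>, subadditivity at \<open>- x\<close> and \<open>- y\<close> is
  superadditivity at \<open>x\<close> and \<open>y\<close>.\<close>

lemma sublinear_odd_imp_linear:
  fixes q :: "'v::real_vector \<Rightarrow> real"
  assumes q: "sublinear q" and odd: "\<And>x. q (- x) \<le> - q x"
  shows "linear q"
proof (rule linearI)
  have eq: "q (- x) = - q x" for x
    using odd[of x] sublinear_minus[OF q, of "- x"] by simp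
  show "q (x + y) = q x + q y" for x y
  proof (rule antisym)
    show "q (x + y) \<le> q x + q y"
      by (rule sublinear_add[OF q])
    show "q x + q y \<le> q (x + y)"
      using sublinear_add[OF q, of "- x" "- y"] eq[of "x + y"] by (simp add: eq)
  qed
  show "q (c *\<^sub>R x) = c *\<^sub>R q x" for c x
  proof (cases "0 \<le> c")
    case True
    then show ?thesis
      by (simp add: sublinear_scaleR[OF q])
  next
    case False
    then show ?thesis
      using sublinear_scaleR[OF q, of "- c" x] eq[of "c *\<^sub>R x"] by simp
  qed
qed

text \<open>Take \<open>r v\<close> as the infimum of \<open>q (v + c *\<^sub>R w) - c * b\<close>
  over \<open>c \<ge> 0\<close> and \<open>w\<close> in \<open>K\<close>. The choice
  \<open>c = 1\<close> at \<open>- w\<close> gives \<open>- b\<close>; the infimum is finite because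
  \<open>q\<close> is at least \<open>b\<close> on \<open>K\<close>, and sublinear because these
  pairs form a convex cone \<open>D\<close>.\<close>

lemma sublinear_minorant:
  fixes q :: "'v::real_vector \<Rightarrow> real"
  assumes q: "sublinear q" and "convex K" and K: "\<And>w. w \<in> K \<Longrightarrow> b \<le> q w"
  obtains r where "sublinear r" "\<And>x. r x \<le> q x" "\<And>w. w \<in> K \<Longrightarrow> r (- w) \<le> - b"
proof -
  define D where "D = convex_cone hull (K \<times> {b})"
  define S where "S v = (\<lambda>d. q (v + fst d) - snd d) ` D" for v
  define r where "r v = Inf (S v)" for v
  have zero: "0 \<in> D" and add: "d \<in> D \<Longrightarrow> e \<in> D \<Longrightarrow> d + e \<in> D"
    and mul: "0 \<le> c \<Longrightarrow> d \<in> D \<Longrightarrow> c *\<^sub>R d \<in> D" for c d e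
    unfolding D_def
    by (simp_all add: convex_cone_hull_contains_0 convex_cone_hull_add convex_cone_hull_mul)
  have D: "snd d \<le> q (fst d)" if "d \<in> D" for d
  proof -
    have "convex (K \<times> {b})"
      using \<open>convex K\<close> by (simp add: convex_Times)
    then have "convex hull (K \<times> {b}) = K \<times> {b}"
      by (simp add: convex_hull_eq)
    with that consider "d = 0" | c w where "d = (c *\<^sub>R w, c * b)" "0 \<le> c" "w \<in> K"
      unfolding D_def convex_cone_hull_convex_hull by auto
    then show ?thesis
      by cases (use K in \<open>simp_all add: sublinear_scaleR[OF q] sublinear_zero[OF q] mult_left_mono\<close>)
  qed
  \<comment> \<open>The left side does not depend on \<open>d\<close>, so the infimum defining
    \<open>r v\<close> is a genuine one.\<close>
  have lower: "- q (- v) \<le> q (v + fst d) - snd d" if "d \<in> D" for v d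
    using D[OF that] sublinear_add[OF q, of "v + fst d" "- v"] by simp
  have bdd: "bdd_below (S v)" for v
    unfolding S_def using lower by (intro bdd_belowI2)
  have upper: "r v \<le> q (v + fst d) - snd d" if "d \<in> D" for v d
    unfolding r_def using that by (intro cInf_lower bdd) (simp add: S_def)
  have greatest: "z \<le> r v" if "\<And>d. d \<in> D \<Longrightarrow> z \<le> q (v + fst d) - snd d" for z v
    unfolding r_def using zero that by (intro cInf_greatest) (auto simp: S_def)
  have le: "r v \<le> q v" for v
    using upper[OF zero, of v] by simp
  have "sublinear r"
  proof (rule sublinearI)
    show "r 0 = 0"
      using le[of 0] greatest[of 0 0] D by (simp add: sublinear_zero[OF q])
    show "r (x + y) \<le> r x + r y" for x y
    proof -
      have "r (x + y) - (q (x + fst d) - snd d) \<le> r y" if d: "d \<in> D" for d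
      proof (rule greatest)
        fix e assume "e \<in> D"
        then have "r (x + y) \<le> q (x + y + fst (d + e)) - snd (d + e)"
          using d by (intro upper add)
        also have "\<dots> \<le> q (x + fst d) + q (y + fst e) - snd d - snd e"
          using sublinear_add[OF q, of "x + fst d" "y + fst e"] by (simp add: algebra_simps)
        finally show "r (x + y) - (q (x + fst d) - snd d) \<le> q (y + fst e) - snd e"
          by simp
      qed
      then have "r (x + y) - r y \<le> r x"
        by (intro greatest) (simp add: algebra_simps)
      then show ?thesis
        by simp
    qed
    show "r (c *\<^sub>R x) \<le> c * r x" if c: "0 < c" for c x
    proof -
      have "r (c *\<^sub>R x) / c \<le> r x"
      proof (rule greatest)
        fix d assume "d \<in> D"
        then have "r (c *\<^sub>R x) \<le> q (c *\<^sub>R x + fst (c *\<^sub>R d)) - snd (c *\<^sub>R d)"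
          using c by (intro upper mul) auto
        also have "\<dots> = c * (q (x + fst d) - snd d)"
          using c sublinear_scaleR[OF q, of c "x + fst d"] by (simp add: algebra_simps)
        finally show "r (c *\<^sub>R x) / c \<le> q (x + fst d) - snd d"
          using c by (simp add: field_simps)
      qed
      then show ?thesis
        using c by (simp add: field_simps)
    qed
  qed
  moreover have "r (- w) \<le> - b" if "w \<in> K" for w
  proof -
    have "(w, b) \<in> D"
      unfolding D_def using that by (intro hull_inc) simp
    from upper[OF this, of "- w"] show ?thesis
      by (simp add: sublinear_zero[OF q])
  qed
  ultimately show ?thesis
    using le that by blast
qed

text \<open>
  A minimal sublinear functional is odd, hence linear, because the preceding lemma with a one-point
  set cannot lower it.
\<close>

lemma linear_minorant:
  fixes q :: "'v::real_vector \<Rightarrow> real"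
  assumes q: "sublinear q"
  obtains L where "linear L" "\<And>x. L x \<le> q x"
proof -
  define A where "A = {r. sublinear r \<and> r \<le> q}"
  \<comment> \<open>Zorn's lemma for the reversed order: a maximal element is a minimal sublinear
    functional below \<open>q\<close>, and chains are bounded by their pointwise infimum.\<close>
  have "\<exists>m\<in>A. \<forall>a\<in>A. m \<ge> a \<longrightarrow> a = m"
  proof (rule predicate_Zorn[where P = "(\<ge>)"])
    show "partial_order_on A (relation_of (\<ge>) A)"
      by (rule partial_order_on_relation_ofI) auto
    fix C assume "C \<in> Chains (relation_of (\<ge>) A)"
    then have CA: "C \<subseteq> A" and chain: "\<And>r s. r \<in> C \<Longrightarrow> s \<in> C \<Longrightarrow> r \<le> s \<or> s \<le> r"
      by (auto simp: Chains_def relation_of_def)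
    show "\<exists>u\<in>A. \<forall>a\<in>C. u \<le> a"
    proof (cases "C = {}")
      case True
      then show ?thesis
        using q by (auto simp: A_def)
    next
      case False
      define u where "u x = Inf ((\<lambda>r. r x) ` C)" for x
      have C: "sublinear r" "r x \<le> q x" if "r \<in> C" for r x
        using CA that by (auto simp: A_def le_fun_def)
      have "- q (- x) \<le> r x" if "r \<in> C" for r x
        using sublinear_minus[OF C(1), OF that, of x] C(2)[OF that, of "- x"] by linarith
      then have lower: "u x \<le> r x" if "r \<in> C" for r x
        unfolding u_def using that by (intro cInf_lower imageI bdd_belowI2)
      have greatest: "z \<le> u x" if "\<And>r. r \<in> C \<Longrightarrow> z \<le> r x" for z x
        unfolding u_def using False that by (intro cInf_greatest) auto
      have "sublinear u"
      proof (rule sublinearI)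
        have "(\<lambda>r. r 0) ` C = {0}"
          using False sublinear_zero[OF C(1)] by (force simp: image_iff)
        then show "u 0 = 0"
          by (simp add: u_def)
        show "u (x + y) \<le> u x + u y" for x y
        proof -
          \<comment> \<open>An infimum of sublinear functionals need not be subadditive; in a chain
            the smaller of \<open>r\<close> and \<open>s\<close> serves for both arguments.\<close>
          have le: "u (x + y) \<le> r x + s y" if "r \<in> C" "s \<in> C" for r s
          proof -
            obtain t where t: "t \<in> C" "t \<le> r" "t \<le> s"
              using chain[of r s] \<open>r \<in> C\<close> \<open>s \<in> C\<close> by blast
            have "u (x + y) \<le> t x + t y"
              using lower[OF t(1)] sublinear_add[OF C(1)[OF t(1)]] order_trans by blast
            also have "\<dots> \<le> r x + s y"
              using t by (intro add_mono) (auto simp: le_fun_def)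
            finally show ?thesis .
          qed
          have "u (x + y) - r x \<le> u y" if "r \<in> C" for r
          proof (rule greatest)
            show "u (x + y) - r x \<le> s y" if "s \<in> C" for s
              using le[OF \<open>r \<in> C\<close> that] by simp
          qed
          then have "u (x + y) - u y \<le> r x" if "r \<in> C" for r
            using that by fastforce
          then have "u (x + y) - u y \<le> u x"
            by (rule greatest)
          then show ?thesis
            by simp
        qed
        show "u (c *\<^sub>R x) \<le> c * u x" if c: "0 < c" for c x
        proof -
          have "u (c *\<^sub>R x) / c \<le> u x"
          proof (rule greatest)
            fix r assume "r \<in> C"
            then show "u (c *\<^sub>R x) / c \<le> r x"
              using lower[of r "c *\<^sub>R x"] c sublinear_scaleR[OF C(1), of r c x]
              by (simp add: field_simps)
          qed
          then show ?thesis
            using c by (simp add: field_simps)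
        qed
      qed
      moreover have "u \<le> q"
        using False C(2) lower order_trans by (auto simp: le_fun_def) blast
      ultimately show ?thesis
        using lower by (auto simp: A_def le_fun_def)
    qed
  qed
  then obtain m where m: "sublinear m" "m \<le> q"
    and min: "\<And>a. sublinear a \<Longrightarrow> a \<le> m \<Longrightarrow> a = m"
    unfolding A_def by (auto dest: order_trans)
  have "m (- x) \<le> - m x" for x
  proof (rule sublinear_minorant[OF m(1), of "{x}" "m x"])
    fix r assume "sublinear r" "\<And>v. r v \<le> m v" "\<And>w. w \<in> {x} \<Longrightarrow> r (- w) \<le> - m x"
    then show "m (- x) \<le> - m x"
      using min[of r] by (auto simp: le_fun_def)
  qed auto
  then have "linear m"
    by (rule sublinear_odd_imp_linear[OF m(1)])
  with m(2) show ?thesis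
    using that by (auto simp: le_fun_def)
qed

text \<open>\<open>sublinear_minorant\<close> encodes the bound on \<open>K\<close> as an upper
  bound at \<open>- w\<close>. Every linear minorant inherits it, and linearity turns it back into
  \<open>b \<le> L w\<close>.\<close>

theorem mazur_orlicz:
  fixes q :: "'v::real_vector \<Rightarrow> real"
  assumes "sublinear q" "convex K" "\<And>w. w \<in> K \<Longrightarrow> b \<le> q w"
  obtains L where "linear L" "\<And>x. L x \<le> q x" "\<And>w. w \<in> K \<Longrightarrow> b \<le> L w"
proof -
  obtain r where r: "sublinear r" "\<And>x. r x \<le> q x" "\<And>w. w \<in> K \<Longrightarrow> r (- w) \<le> - b"
    using sublinear_minorant[OF assms] by blast
  obtain L where L: "linear L" "\<And>x. L x \<le> r x"
    using linear_minorant[OF r(1)] by blast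
  have "b \<le> L w" if "w \<in> K" for w
    using r(3)[OF that] L(2)[of "- w"] by (simp add: linear_neg[OF L(1)])
  with L r(2) show ?thesis
    using that order_trans by blast
qed

section \<open>Halving by infratype\<close>

lemma infratype_boundE:
  fixes u :: "nat \<Rightarrow> 'e::real_normed_vector"
  assumes "infratype_bound TYPE('e) p I"
  obtains \<theta> :: "nat \<Rightarrow> real" where "\<And>i. i < m \<Longrightarrow> \<theta> i = 1 \<or> \<theta> i = -1"
    and "norm (\<Sum>i<m. \<theta> i *\<^sub>R u i) \<le> I * (\<Sum>i<m. norm (u i) powr p) powr (1 / p)"
proof -
  let ?T = "{..<m} \<rightarrow>\<^sub>E {-1, 1::real}"
  let ?S = "(\<lambda>\<theta>. norm (\<Sum>i<m. \<theta> i *\<^sub>R u i)) ` ?T"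
  have "finite ?T"
    by (intro finite_PiE) auto
  moreover have "?T \<noteq> {}"
    by (simp add: PiE_eq_empty_iff)
  ultimately have "Min ?S \<in> ?S"
    by (intro Min_in) auto
  then obtain \<theta> where \<theta>: "\<theta> \<in> ?T" "Min ?S = norm (\<Sum>i<m. \<theta> i *\<^sub>R u i)"
    by blast
  moreover have "Min ?S \<le> I * (\<Sum>i<m. norm (u i) powr p) powr (1 / p)"
    using assms unfolding infratype_bound_def by blast
  ultimately show ?thesis
    using that[of \<theta>] by auto
qed

text \<open>
  The choice taking \<open>a i\<close> for \<open>\<theta> i = 1\<close> and \<open>a (n + i)\<close> otherwise and its complement move the mean of
  the first components by opposite vectors, so the second components may decide between the two.
\<close>

lemma halve_sequence:
  fixes a :: "nat \<Rightarrow> 'e::real_normed_vector \<times> real"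
  assumes I: "infratype_bound TYPE('e) p I" and p: "0 < p" and n: "0 < n"
    and a: "\<And>i. i < 2 * n \<Longrightarrow> norm (fst (a i)) \<le> 1"
  obtains b where "b ` {..<n} \<subseteq> a ` {..<2 * n}"
    and "norm ((\<Sum>i<n. fst (b i)) /\<^sub>R n - (\<Sum>i<2 * n. fst (a i)) /\<^sub>R (2 * n))
      \<le> I * real n powr (-1 + 1 / p)"
    and "(\<Sum>i<2 * n. snd (a i)) / (2 * n) \<le> (\<Sum>i<n. snd (b i)) / n"
proof -
  have I0: "0 \<le> I"
    using I by (simp add: infratype_bound_def)
  define w where "w i = fst (a i) - fst (a (n + i))" for i
  obtain \<theta> :: "nat \<Rightarrow> real" where \<theta>: "\<And>i. i < n \<Longrightarrow> \<theta> i = 1 \<or> \<theta> i = -1"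
    and le: "norm (\<Sum>i<n. \<theta> i *\<^sub>R w i) \<le> I * (\<Sum>i<n. norm (w i) powr p) powr (1 / p)"
    using infratype_boundE[OF I, of n w] by blast
  have "norm (w i) \<le> 2" if "i < n" for i
    using norm_triangle_ineq4[of "fst (a i)" "fst (a (n + i))"] a[of i] a[of "n + i"] that
    by (simp add: w_def)
  then have "(\<Sum>i<n. norm (w i) powr p) \<le> (\<Sum>i<n. 2 powr p)"
    using p by (intro sum_mono powr_mono2) auto
  then have "(\<Sum>i<n. norm (w i) powr p) powr (1 / p) \<le> (n * 2 powr p) powr (1 / p)"
    using p by (intro powr_mono2) (auto simp: sum_nonneg)
  also have "\<dots> = 2 * n powr (1 / p)"
    using p by (simp add: powr_mult powr_powr)
  finally have "norm (\<Sum>i<n. \<theta> i *\<^sub>R w i) \<le> I * (2 * n powr (1 / p))"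
    using le I0 mult_left_mono order_trans by blast
  \<comment> \<open>The mean over \<open>n\<close> terms moves by half the signed sum divided by
    \<open>n\<close>; this half cancels the \<open>2\<close> coming from
    \<open>norm (w i) \<le> 2\<close>.\<close>
  then have "norm (\<Sum>i<n. \<theta> i *\<^sub>R w i) / (2 * n) \<le> I * (2 * n powr (1 / p)) / (2 * n)"
    by (intro divide_right_mono) auto
  also have "\<dots> = I * (real n powr (1 / p) / n)"
    by simp
  also have "real n powr (1 / p) / n = real n powr (-1 + 1 / p)"
    unfolding powr_add using n by (simp add: powr_minus_divide)
  finally have bound: "norm (\<Sum>i<n. \<theta> i *\<^sub>R w i) / (2 * n) \<le> I * real n powr (-1 + 1 / p)" .
  define b where "b s i = (if \<theta> i = s then a i else a (n + i))" for s i
  have sub: "b s ` {..<n} \<subseteq> a ` {..<2 * n}" for s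
    by (auto simp: b_def)
  have split: "(\<Sum>i<2 * n. g i) = (\<Sum>i<n. g i + g (n + i))" for g :: "nat \<Rightarrow> 'x::comm_monoid_add"
    using sum.atLeastLessThan_shift_bounds[of g 0 n n] sum.atLeastLessThan_concat[of 0 n "2 * n" g]
    by (simp add: sum.distrib atLeast0LessThan mult_2 add.commute)
  have close: "norm ((\<Sum>i<n. fst (b s i)) /\<^sub>R n - (\<Sum>i<2 * n. fst (a i)) /\<^sub>R (2 * n))
      \<le> I * real n powr (-1 + 1 / p)" if s: "s = 1 \<or> s = -1" for s
  proof -
    \<comment> \<open>The chosen point is the midpoint of its pair plus or minus half the
      difference, with sign \<open>s * \<theta> i\<close>.\<close>
    have "2 *\<^sub>R fst (b s i) = fst (a i) + fst (a (n + i)) + s *\<^sub>R \<theta> i *\<^sub>R w i" if "i < n" for i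
      using s \<theta>[OF that] by (auto simp: b_def w_def algebra_simps scaleR_2)
    then have "2 *\<^sub>R (\<Sum>i<n. fst (b s i))
        = (\<Sum>i<2 * n. fst (a i)) + s *\<^sub>R (\<Sum>i<n. \<theta> i *\<^sub>R w i)"
      unfolding split by (simp add: scaleR_sum_right sum.distrib)
    moreover have "(\<Sum>i<n. fst (b s i)) /\<^sub>R n = (2 *\<^sub>R (\<Sum>i<n. fst (b s i))) /\<^sub>R (2 * n)"
      by simp
    ultimately have "(\<Sum>i<n. fst (b s i)) /\<^sub>R n - (\<Sum>i<2 * n. fst (a i)) /\<^sub>R (2 * n)
        = (s / (2 * n)) *\<^sub>R (\<Sum>i<n. \<theta> i *\<^sub>R w i)"
      by (simp only: scaleR_add_right add_diff_cancel_left' scaleR_scaleR divide_inverse mult.commute)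
    then have "norm ((\<Sum>i<n. fst (b s i)) /\<^sub>R n - (\<Sum>i<2 * n. fst (a i)) /\<^sub>R (2 * n))
        = norm (\<Sum>i<n. \<theta> i *\<^sub>R w i) / (2 * n)"
      using s by auto
    then show ?thesis
      using bound by simp
  qed
  \<comment> \<open>The two complementary choices use every term exactly once, so one of them
    carries at least half of the total.\<close>
  have "(\<Sum>i<2 * n. snd (a i)) = (\<Sum>i<n. snd (b 1 i)) + (\<Sum>i<n. snd (b (-1) i))"
    unfolding split sum.distrib[symmetric]
    using \<theta> by (intro sum.cong) (auto simp: b_def)
  then consider "(\<Sum>i<2 * n. snd (a i)) \<le> 2 * (\<Sum>i<n. snd (b 1 i))"
    | "(\<Sum>i<2 * n. snd (a i)) \<le> 2 * (\<Sum>i<n. snd (b (-1) i))"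
    by linarith
  then show ?thesis
  proof cases
    case 1
    then show ?thesis
      using n by (intro that[OF sub close, of 1]) (auto simp: field_simps)
  next
    case 2
    then show ?thesis
      using n by (intro that[OF sub close, of "-1"]) (auto simp: field_simps)
  qed
qed

text \<open>Iterates \<open>halve_sequence\<close>: the step that leaves \<open>k * 2 ^ j\<close>
  terms contributes the summand for \<open>j\<close>. Terms are only selected, never altered, so the
  norm bound survives each step.\<close>

lemma select_subsequence:
  fixes a :: "nat \<Rightarrow> 'e::real_normed_vector \<times> real"
  assumes I: "infratype_bound TYPE('e) p I" and p: "0 < p" and k: "0 < k"
    and a: "\<And>i. i < k * 2 ^ m \<Longrightarrow> norm (fst (a i)) \<le> 1"
  obtains b where "b ` {..<k} \<subseteq> a ` {..<k * 2 ^ m}"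
    and "norm ((\<Sum>i<k. fst (b i)) /\<^sub>R k - (\<Sum>i<k * 2 ^ m. fst (a i)) /\<^sub>R (k * 2 ^ m))
      \<le> (\<Sum>j<m. I * real (k * 2 ^ j) powr (-1 + 1 / p))"
    and "(\<Sum>i<k * 2 ^ m. snd (a i)) / (k * 2 ^ m) \<le> (\<Sum>i<k. snd (b i)) / k"
  using a
proof (induction m arbitrary: a thesis)
  case 0
  show ?case
    by (rule 0(1)[of a]) auto
next
  case (Suc m)
  have "2 * (k * 2 ^ m) = k * 2 ^ Suc m"
    by simp
  \<comment> \<open>The identity is used for the index bound in the naturals and for the divisor in
    the reals.\<close>
  note eq = this this[THEN arg_cong[of _ _ real]]
  obtain c where c: "c ` {..<k * 2 ^ m} \<subseteq> a ` {..<k * 2 ^ Suc m}"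
    "norm ((\<Sum>i<k * 2 ^ m. fst (c i)) /\<^sub>R (k * 2 ^ m)
        - (\<Sum>i<k * 2 ^ Suc m. fst (a i)) /\<^sub>R (k * 2 ^ Suc m))
      \<le> I * real (k * 2 ^ m) powr (-1 + 1 / p)"
    "(\<Sum>i<k * 2 ^ Suc m. snd (a i)) / (k * 2 ^ Suc m) \<le> (\<Sum>i<k * 2 ^ m. snd (c i)) / (k * 2 ^ m)"
    using halve_sequence[OF I p, of "k * 2 ^ m" a] Suc.prems(2) k unfolding eq by auto
  have "norm (fst (c i)) \<le> 1" if i: "i < k * 2 ^ m" for i
  proof -
    have "c i \<in> a ` {..<k * 2 ^ Suc m}"
      using i c(1) by blast
    then show ?thesis
      using Suc.prems(2) by auto
  qed
  then obtain b where b: "b ` {..<k} \<subseteq> c ` {..<k * 2 ^ m}"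
    "norm ((\<Sum>i<k. fst (b i)) /\<^sub>R k - (\<Sum>i<k * 2 ^ m. fst (c i)) /\<^sub>R (k * 2 ^ m))
      \<le> (\<Sum>j<m. I * real (k * 2 ^ j) powr (-1 + 1 / p))"
    "(\<Sum>i<k * 2 ^ m. snd (c i)) / (k * 2 ^ m) \<le> (\<Sum>i<k. snd (b i)) / k"
    using Suc.IH[of c] by blast
  show ?case
  proof (rule Suc.prems(1))
    show "b ` {..<k} \<subseteq> a ` {..<k * 2 ^ Suc m}"
      using b(1) c(1) by blast
    show "norm ((\<Sum>i<k. fst (b i)) /\<^sub>R k - (\<Sum>i<k * 2 ^ Suc m. fst (a i)) /\<^sub>R (k * 2 ^ Suc m))
      \<le> (\<Sum>j<Suc m. I * real (k * 2 ^ j) powr (-1 + 1 / p))"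
      using norm_diff_triangle_le[OF b(2) c(2)] by simp
    show "(\<Sum>i<k * 2 ^ Suc m. snd (a i)) / (k * 2 ^ Suc m) \<le> (\<Sum>i<k. snd (b i)) / k"
      using b(3) c(3) by simp
  qed
qed

section \<open>Finite sums: geometric error, separate suprema, multiplicities\<close>

lemma sum_geometric_powr_le:
  assumes "x < 0" "0 \<le> c" "0 < k"
  shows "(\<Sum>j<m. c * real (k * 2 ^ j) powr x) \<le> c * real k powr x / (1 - 2 powr x)"
proof -
  have r: "0 < 2 powr x" "2 powr x < 1"
    using assms(1) by (auto simp: powr_less_one)
  have "(\<Sum>j<m. c * real (k * 2 ^ j) powr x) = c * real k powr x * (\<Sum>j<m. (2 powr x) ^ j)"
    by (simp add: sum_distrib_left powr_mult mult.assoc powr_powr mult.commute[of x]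
        flip: powr_realpow)
  also have "(\<Sum>j<m. (2 powr x) ^ j) \<le> 1 / (1 - 2 powr x)"
    using r assms(1) by (simp add: sum_gp_strict divide_right_mono)
  finally show ?thesis
    using assms by (simp add: mult_left_mono)
qed

text \<open>Coordinates vary independently, so the supremum of the sum is the sum of the suprema,
  which serve as \<open>H\<close>. Each is finite because the other coordinates can be held fixed.
  This splits one inequality over all tuples into a bound for each index.\<close>

lemma sum_sup_le:
  fixes g :: "'i \<Rightarrow> 'b \<Rightarrow> real"
  assumes "finite F" and "\<And>i. i \<in> F \<Longrightarrow> S i \<noteq> {}"
    and "\<And>x. (\<And>i. i \<in> F \<Longrightarrow> x i \<in> S i) \<Longrightarrow> (\<Sum>i\<in>F. g i (x i)) \<le> M"
  obtains H where "\<And>i y. i \<in> F \<Longrightarrow> y \<in> S i \<Longrightarrow> g i y \<le> H i" and "(\<Sum>i\<in>F. H i) \<le> M"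
  using assms
proof (induction F arbitrary: M thesis rule: finite_induct)
  case empty
  show ?case
    by (rule empty.prems(1)) (use empty.prems(3) in auto)
next
  case (insert j F)
  define s where "s = Sup (g j ` S j)"
  have le: "g j y \<le> M - (\<Sum>i\<in>F. g i (x i))" if "y \<in> S j" "\<And>i. i \<in> F \<Longrightarrow> x i \<in> S i" for x y
  proof -
    have "(\<Sum>i\<in>insert j F. g i ((x(j := y)) i)) \<le> M"
      using that by (intro insert.prems(3)) auto
    moreover have "(\<Sum>i\<in>F. g i ((x(j := y)) i)) = (\<Sum>i\<in>F. g i (x i))"
      using insert.hyps by (intro sum.cong) auto
    ultimately show ?thesis
      using insert.hyps by simp
  qed
  have "(\<Sum>i\<in>F. g i (x i)) \<le> M - s" if "\<And>i. i \<in> F \<Longrightarrow> x i \<in> S i" for x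
  proof -
    have "s \<le> M - (\<Sum>i\<in>F. g i (x i))"
      unfolding s_def using insert.prems(2) le[OF _ that] by (intro cSup_least) auto
    then show ?thesis
      by simp
  qed
  then obtain H where H: "\<And>i y. i \<in> F \<Longrightarrow> y \<in> S i \<Longrightarrow> g i y \<le> H i" "(\<Sum>i\<in>F. H i) \<le> M - s"
    using insert.IH[of "M - s"] insert.prems(2) by auto
  have "\<exists>x. \<forall>i\<in>F. x i \<in> S i"
    using insert.prems(2) by (intro bchoice) auto
  then obtain x where "\<And>i. i \<in> F \<Longrightarrow> x i \<in> S i"
    by blast
  then have "bdd_above (g j ` S j)"
    using le by (intro bdd_aboveI2) auto
  then have "g j y \<le> s" if "y \<in> S j" for y
    unfolding s_def using that by (intro cSup_upper) auto
  moreover have "(\<Sum>i\<in>F. (H(j := s)) i) = sum H F"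
    using insert.hyps by (intro sum.cong) auto
  ultimately show ?case
    using H insert.hyps by (intro insert.prems(1)[of "H(j := s)"]) auto
qed

text \<open>Halving acts on unweighted sequences, so integer weights are realised by
  repetition.\<close>

lemma list_of_multiplicities:
  fixes g :: "'i \<Rightarrow> 'b::real_vector"
  assumes "finite F"
  obtains xs where "length xs = (\<Sum>i\<in>F. n i)" "set xs \<subseteq> g ` F"
    "sum_list xs = (\<Sum>i\<in>F. real (n i) *\<^sub>R g i)"
  using assms
proof (induction F arbitrary: thesis rule: finite_induct)
  case empty
  show ?case
    by (rule empty.prems[of "[]"]) auto
next
  case (insert j F)
  then obtain xs where "length xs = (\<Sum>i\<in>F. n i)" "set xs \<subseteq> g ` F"
    "sum_list xs = (\<Sum>i\<in>F. real (n i) *\<^sub>R g i)"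
    by metis
  moreover have "sum_list (replicate l c) = real l *\<^sub>R c" for l and c :: 'b
    by (induction l) (auto simp: algebra_simps)
  ultimately show ?case
    using insert.hyps
    by (intro insert.prems[of "replicate (n j) (g j) @ xs"]) auto
qed

section \<open>Separation of a finite family and the Helly bound\<close>

lemma sum_fun_apply: "(\<Sum>i\<in>A. g i) x = (\<Sum>i\<in>A. g i x)"
  for g :: "'i \<Rightarrow> 'b \<Rightarrow> 'c::comm_monoid_add"
  by (induction A rule: infinite_finite_induct) auto

text \<open>Choose points of the \<open>C i\<close> and subtract one common vector \<open>x\<close>:
  by \<open>far\<close> the resulting tuple has maximum norm at least \<open>b\<close>. Such tuples
  form a convex set \<open>K\<close>, and Mazur-Orlicz gives a functional that is at least
  \<open>b\<close> on it.\<close>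

lemma separating_functionals:
  fixes C :: "'i \<Rightarrow> 'a::real_normed_vector set"
  assumes F: "finite F" "F \<noteq> {}" and C: "\<And>i. i \<in> F \<Longrightarrow> convex (C i)" "\<And>i. i \<in> F \<Longrightarrow> C i \<noteq> {}"
    and far: "\<And>x. \<exists>i\<in>F. \<forall>y\<in>C i. b \<le> norm (y - x)"
  obtains f :: "'i \<Rightarrow> 'a \<Rightarrow>\<^sub>L real" and l h :: "'i \<Rightarrow> real"
  where "(\<Sum>i\<in>F. f i) = 0" "\<And>i. i \<in> F \<Longrightarrow> norm (f i) \<le> l i" "(\<Sum>i\<in>F. l i) \<le> 1"
    "\<And>i y. i \<in> F \<Longrightarrow> y \<in> C i \<Longrightarrow> h i \<le> f i y" "b \<le> (\<Sum>i\<in>F. h i)"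
proof -
  \<comment> \<open>A linear functional \<open>\<le> q\<close> on the power is a tuple of functionals whose norms add up to at most \<open>1\<close>;
    invariance of \<open>K\<close> under translation along the diagonal makes their sum vanish.\<close>
  define q :: "('i \<Rightarrow> 'a) \<Rightarrow> real" where "q v = Max ((\<lambda>i. norm (v i)) ` F)" for v
  have q_ge: "norm (v i) \<le> q v" if "i \<in> F" for v i
    unfolding q_def using that F by (intro Max_ge) auto
  have q_le: "q v \<le> z" if "\<And>i. i \<in> F \<Longrightarrow> norm (v i) \<le> z" for v z
    unfolding q_def using that F by (intro Max.boundedI) auto
  obtain i0 where i0: "i0 \<in> F"
    using F by auto
  have "sublinear q"
  proof (rule sublinearI)
    show "q (x + y) \<le> q x + q y" for x y
      by (intro q_le) (auto intro!: norm_triangle_mono q_ge)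
    show "q 0 = 0"
      using q_le[of 0 0] q_ge[OF i0, of 0] by simp
    show "q (c *\<^sub>R x) \<le> c * q x" if "0 < c" for c x
      using that by (intro q_le) (auto intro: q_ge mult_left_mono)
  qed
  moreover define K where "K = {v. \<exists>x. \<forall>i\<in>F. v i + x \<in> C i}"
  have "convex K"
  proof (rule convexI)
    fix v w and s t :: real assume vw: "v \<in> K" "w \<in> K" and st: "0 \<le> s" "0 \<le> t" "s + t = 1"
    obtain x y where xy: "\<And>i. i \<in> F \<Longrightarrow> v i + x \<in> C i" "\<And>i. i \<in> F \<Longrightarrow> w i + y \<in> C i"
      using vw unfolding K_def by blast
    have "(s *\<^sub>R v + t *\<^sub>R w) i + (s *\<^sub>R x + t *\<^sub>R y) \<in> C i" if "i \<in> F" for i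
      using convexD[OF C(1)[OF that] xy(1)[OF that] xy(2)[OF that] st] by (simp add: algebra_simps)
    then show "s *\<^sub>R v + t *\<^sub>R w \<in> K"
      unfolding K_def by blast
  qed
  moreover have "b \<le> q v" if v: "v \<in> K" for v
  proof -
    obtain x where x: "\<And>i. i \<in> F \<Longrightarrow> v i + x \<in> C i"
      using v unfolding K_def by blast
    obtain i where "i \<in> F" "\<forall>y\<in>C i. b \<le> norm (y - x)"
      using far by blast
    with x[of i] have "b \<le> norm (v i)"
      by (metis add_diff_cancel_right')
    also have "\<dots> \<le> q v"
      by (rule q_ge) fact
    finally show ?thesis .
  qed
  ultimately obtain L where L: "linear L" "\<And>v. L v \<le> q v" "\<And>v. v \<in> K \<Longrightarrow> b \<le> L v"
    using mazur_orlicz by blast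
  define e :: "'i \<Rightarrow> 'a \<Rightarrow> 'i \<Rightarrow> 'a" where "e i x = (\<lambda>j. if j = i then x else 0)" for i x
  have e: "e i (x + y) = e i x + e i y" "e i (c *\<^sub>R x) = c *\<^sub>R e i x" for i c x y
    by (auto simp: e_def fun_eq_iff)
  have le_norm: "L (e i x) \<le> norm x" for i x
    by (rule order_trans[OF L(2)]) (auto intro: q_le simp: e_def)
  have "\<bar>L (e i x)\<bar> \<le> norm x" for i x
    using le_norm[of i x] le_norm[of i "- x"] e(2)[of i "-1" x] linear_neg[OF L(1), of "e i x"]
    by (simp add: abs_le_iff)
  then have bl: "bounded_linear (\<lambda>x. L (e i x))" for i
    by (intro bounded_linear_intro[of _ 1]) (simp_all add: e linear_add[OF L(1)] linear_scale[OF L(1)])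
  define f where "f i = Blinfun (\<lambda>x. L (e i x))" for i
  have f: "f i x = L (e i x)" for i x
    by (simp add: f_def bounded_linear_Blinfun_apply[OF bl])
  have L_eq: "L v = (\<Sum>i\<in>F. f i (v i))" for v
  proof -
    \<comment> \<open>\<open>q\<close> ignores coordinates outside \<open>F\<close>, so
      \<open>L\<close> vanishes on the remainder \<open>d\<close>, even when the index type is
      infinite.\<close>
    define d where "d = v - (\<Sum>i\<in>F. e i (v i))"
    have "d i = 0" if "i \<in> F" for i
      using that F(1) by (simp add: d_def sum_fun_apply e_def)
    then have "L d \<le> 0" "L (- d) \<le> 0"
      using L(2)[of d] L(2)[of "- d"] q_le[of d 0] q_le[of "- d" 0] by auto
    then have "L d = 0"
      using linear_neg[OF L(1), of d] by simp
    then show ?thesis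
      by (simp add: d_def linear_diff[OF L(1)] linear_sum[OF L(1)] f)
  qed
  \<comment> \<open>Independent choices from the unit ball have \<open>q x \<le> 1\<close>; their
    separate suprema bound the norms of the \<open>f i\<close>.\<close>
  have "(\<Sum>i\<in>F. f i (x i)) \<le> 1" if "\<And>i. i \<in> F \<Longrightarrow> x i \<in> cball 0 1" for x
    using L(2)[of x] q_le[of x 1] that by (auto simp: L_eq)
  then obtain l where l: "\<And>i y. i \<in> F \<Longrightarrow> y \<in> cball 0 1 \<Longrightarrow> f i y \<le> l i" "(\<Sum>i\<in>F. l i) \<le> 1"
    using sum_sup_le[OF F(1), of "\<lambda>_. cball 0 1" f 1] by auto
  have "norm (f i) \<le> l i" if "i \<in> F" for i
  proof (rule norm_blinfun_bound)
    show "0 \<le> l i"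
      using l(1)[OF that, of 0] by simp
    show "norm (f i x) \<le> l i * norm x" for x
    proof (cases "x = 0")
      case False
      then show ?thesis
        using l(1)[OF that, of "x /\<^sub>R norm x"] l(1)[OF that, of "- x /\<^sub>R norm x"]
        by (simp add: blinfun.minus_right blinfun.scaleR_right abs_le_iff field_simps)
    qed simp
  qed
  \<comment> \<open>\<open>sum_sup_le\<close> produces upper bounds, hence the negated functionals;
    the final lower bounds are \<open>- h i\<close>.\<close>
  moreover have "(\<Sum>i\<in>F. - f i (x i)) \<le> - b" if "\<And>i. i \<in> F \<Longrightarrow> x i \<in> C i" for x
  proof -
    have "x \<in> K"
      unfolding K_def using that by (auto intro: exI[of _ 0])
    from L(3)[OF this] show ?thesis
      by (simp add: L_eq sum_negf)
  qed
  then obtain h where h: "\<And>i y. i \<in> F \<Longrightarrow> y \<in> C i \<Longrightarrow> - f i y \<le> h i" "(\<Sum>i\<in>F. h i) \<le> - b"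
    using sum_sup_le[where S = C and g = "\<lambda>i x. - f i x" and M = "- b", OF F(1) C(2)] by blast
  moreover have "(\<Sum>i\<in>F. f i) = 0"
  proof (rule blinfun_eqI)
    fix x
    define s where "s = L (\<lambda>_. x)"
    have "\<exists>v. \<forall>i\<in>F. v i \<in> C i"
      using C(2) by (intro bchoice) auto
    then obtain v where v: "\<And>i. i \<in> F \<Longrightarrow> v i \<in> C i"
      by blast
    have "b \<le> L v + t * s" for t
    proof -
      have "v + t *\<^sub>R (\<lambda>_. x) \<in> K"
        unfolding K_def using v by (auto intro!: exI[of _ "- t *\<^sub>R x"])
      from L(3)[OF this] show ?thesis
        by (simp add: s_def linear_add[OF L(1)] linear_scale[OF L(1)])
    qed
    \<comment> \<open>For \<open>s \<noteq> 0\<close> this multiple would give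
      \<open>L v + t * s = b - 1\<close>.\<close>
    from this[of "(b - L v - 1) / s"] have "s = 0"
      by (cases "s = 0") auto
    then show "blinfun_apply (\<Sum>i\<in>F. f i) x = blinfun_apply 0 x"
      by (simp add: s_def L_eq blinfun.sum_left)
  qed
  ultimately show ?thesis
    using l(2) by (intro that[of f l "\<lambda>i. - h i"]) (force simp: sum_negf)+
qed

text \<open>An index \<open>i\<close> with \<open>l i = 0\<close> contributes \<open>f i /\<^sub>R 0 = 0\<close>, which is harmless since then \<open>f i = 0\<close>.\<close>

lemma round_convex_combination:
  fixes f :: "'i \<Rightarrow> 'e::real_normed_vector" and l h :: "'i \<Rightarrow> real"
  assumes F: "finite F" and f0: "(\<Sum>i\<in>F. f i) = 0" and f: "\<And>i. i \<in> F \<Longrightarrow> norm (f i) \<le> l i"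
    and l: "(\<Sum>i\<in>F. l i) \<le> 1" and h: "\<And>i. i \<in> F \<Longrightarrow> h i \<le> l i"
  obtains a where "a ` {..<N} \<subseteq> insert 0 ((\<lambda>i. (f i /\<^sub>R l i, h i / l i)) ` F)"
    and "norm (\<Sum>j<N. fst (a j)) \<le> card F"
    and "real N * (\<Sum>i\<in>F. h i) - card F \<le> (\<Sum>j<N. snd (a j))"
proof -
  \<comment> \<open>The weights \<open>N * l i\<close> are rounded down. Their total is then at most
    \<open>N\<close>, and zeros fill the sequence up to length \<open>N\<close>.\<close>
  define n where "n i = nat \<lfloor>N * l i\<rfloor>" for i
  have l0: "0 \<le> l i" if "i \<in> F" for i
    using f[OF that] norm_ge_zero order_trans by blast
  have n: "real (n i) \<le> N * l i" "N * l i \<le> real (n i) + 1" if "i \<in> F" for i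
    using l0[OF that] unfolding n_def by (auto simp: le_nat_floor)
  let ?g = "\<lambda>i. (f i /\<^sub>R l i, h i / l i)"
  obtain xs where xs: "length xs = (\<Sum>i\<in>F. n i)" "set xs \<subseteq> ?g ` F"
    "sum_list xs = (\<Sum>i\<in>F. real (n i) *\<^sub>R ?g i)"
    using list_of_multiplicities[OF F] by blast
  have "real (\<Sum>i\<in>F. n i) \<le> (\<Sum>i\<in>F. N * l i)"
    using n by (simp add: sum_mono)
  also have "\<dots> \<le> N"
    using l mult_left_mono[of _ 1 "real N"] by (simp flip: sum_distrib_left)
  finally have len: "length xs \<le> N"
    using xs(1) by linarith
  define ys where "ys = xs @ replicate (N - length xs) 0"
  have ys: "length ys = N" "set ys \<subseteq> insert 0 (?g ` F)"
    using len xs(2) by (auto simp: ys_def)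
  have "sum_list (replicate r (0::'e \<times> real)) = 0" for r
    by (induction r) auto
  then have sum: "(\<Sum>j<N. ys ! j) = (\<Sum>i\<in>F. real (n i) *\<^sub>R ?g i)"
    using sum_list_sum_nth[of ys] ys(1) xs(3) by (simp add: ys_def atLeast0LessThan)
  show ?thesis
  proof (rule that[of "(!) ys"])
    show "(!) ys ` {..<N} \<subseteq> insert 0 (?g ` F)"
      using ys by (metis (no_types, lifting) image_subsetI lessThan_iff nth_mem subsetD)
    \<comment> \<open>Subtracting \<open>N\<close> times the vanishing sum of the \<open>f i\<close>
      leaves only rounding errors, each of norm at most \<open>1\<close>.\<close>
    have "(\<Sum>j<N. fst (ys ! j)) = (\<Sum>i\<in>F. real (n i) *\<^sub>R f i /\<^sub>R l i) - real N *\<^sub>R (\<Sum>i\<in>F. f i)"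
      using arg_cong[OF sum, of fst] f0 by (simp add: fst_sum mult.commute)
    also have "\<dots> = (\<Sum>i\<in>F. (real (n i) / l i - real N) *\<^sub>R f i)"
      by (simp add: scaleR_sum_right sum_subtractf scaleR_diff_left divide_inverse mult.commute)
    also have "norm \<dots> \<le> (\<Sum>i\<in>F. 1)"
    proof (rule sum_norm_le)
      fix i assume i: "i \<in> F"
      show "norm ((real (n i) / l i - real N) *\<^sub>R f i) \<le> 1"
      proof (cases "l i = 0")
        case True
        then show ?thesis
          using f[OF i] by simp
      next
        case False
        then have pos: "0 < l i"
          using l0[OF i] by simp
        have "norm ((real (n i) / l i - real N) *\<^sub>R f i) \<le> \<bar>real (n i) / l i - real N\<bar> * l i"
          using f[OF i] by (simp add: mult_left_mono)
        also have "\<dots> = \<bar>(real (n i) / l i - real N) * l i\<bar>"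
          using pos by (simp add: abs_mult)
        also have "(real (n i) / l i - real N) * l i = real (n i) - N * l i"
          using pos by (simp add: field_simps)
        also have "\<bar>\<dots>\<bar> \<le> 1"
          using n[OF i] by linarith
        finally show ?thesis .
      qed
    qed
    finally show "norm (\<Sum>j<N. fst (ys ! j)) \<le> card F"
      by simp
    have "real N * (\<Sum>i\<in>F. h i) - card F = (\<Sum>i\<in>F. N * h i - 1)"
      by (simp add: sum_subtractf sum_distrib_left)
    also have "\<dots> \<le> (\<Sum>i\<in>F. real (n i) * (h i / l i))"
    proof (rule sum_mono)
      fix i assume i: "i \<in> F"
      show "N * h i - 1 \<le> real (n i) * (h i / l i)"
      proof (cases "l i = 0")
        \<comment> \<open>The quotient is \<open>0\<close> by the convention for division, and
          \<open>h i \<le> l i = 0\<close>.\<close>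
        case True
        then have "N * h i \<le> 0"
          using h[OF i] by (simp add: mult_nonneg_nonpos)
        with True show ?thesis
          by simp
      next
        case False
        then have pos: "0 < l i"
          using l0[OF i] by simp
        \<comment> \<open>The rounding remainder lies between \<open>0\<close> and \<open>1\<close>
          and \<open>h i / l i \<le> 1\<close>, so an index loses at most \<open>1\<close>.\<close>
        have "(N * l i - n i) * (h i / l i) \<le> (N * l i - n i) * 1"
          using n[OF i] h[OF i] pos by (intro mult_left_mono) auto
        also have "\<dots> \<le> 1"
          using n(2)[OF i] by simp
        finally have "(N * l i - n i) * (h i / l i) \<le> 1" .
        moreover have "(N * l i - n i) * (h i / l i) = N * h i - n i * (h i / l i)"
          using pos by (simp add: left_diff_distrib diff_divide_distrib)
        ultimately show ?thesis
          by linarith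
      qed
    qed
    finally show "real N * (\<Sum>i\<in>F. h i) - card F \<le> (\<Sum>j<N. snd (ys ! j))"
      using arg_cong[OF sum, of snd] by (simp add: snd_sum)
  qed
qed

text \<open>With \<open>N = k * 2 ^ m\<close> terms, rounding costs \<open>card F / N\<close> twice:
  once in the mean functional and once in the mean lower bound. Both vanish as \<open>m\<close>
  grows, which leaves only the halving errors.\<close>

lemma far_from_family_bound:
  fixes F :: "'a::real_normed_vector set set"
  assumes I: "infratype_bound TYPE('a \<Rightarrow>\<^sub>L real) p I" and p: "1 < p" and k: "1 \<le> k"
    and F: "finite F" "\<And>C. C \<in> F \<Longrightarrow> convex C" "\<And>C. C \<in> F \<Longrightarrow> C \<subseteq> cball 0 1"
    and inter: "\<And>G. G \<subseteq> F \<Longrightarrow> card G \<le> k \<Longrightarrow> \<Inter>G \<noteq> {}"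
    and far: "\<And>x. \<exists>C\<in>F. \<forall>y\<in>C. b \<le> norm (y - x)"
  shows "b \<le> I * real k powr (-1 + 1 / p) / (1 - 2 powr (-1 + 1 / p))" (is "b \<le> ?R")
proof -
  have ne: "C \<noteq> {}" if "C \<in> F" for C
    using inter[of "{C}"] that k by simp
  have "F \<noteq> {}"
    using far by blast
  then obtain f :: "'a set \<Rightarrow> 'a \<Rightarrow>\<^sub>L real" and l h
    where f0: "(\<Sum>C\<in>F. f C) = 0" and f: "\<And>C. C \<in> F \<Longrightarrow> norm (f C) \<le> l C"
      and l: "(\<Sum>C\<in>F. l C) \<le> 1" and h: "\<And>C y. C \<in> F \<Longrightarrow> y \<in> C \<Longrightarrow> h C \<le> f C y"
      and b: "b \<le> (\<Sum>C\<in>F. h C)"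
    using separating_functionals[OF F(1) _ F(2) ne far] by metis
  have apply_le: "u y \<le> norm u" if "norm y \<le> 1" for u :: "'a \<Rightarrow>\<^sub>L real" and y
    using norm_blinfun[of u y] mult_left_mono[OF that, of "norm u"] by simp
  have hl: "h C \<le> l C" if C: "C \<in> F" for C
  proof -
    obtain y where "y \<in> C"
      using ne[OF C] by blast
    moreover from this have "norm y \<le> 1"
      using F(3)[OF C] by (auto simp: subset_iff)
    ultimately show ?thesis
      using h[OF C] apply_le[of y "f C"] f[OF C] by fastforce
  qed
  have R: "real (k * 2 ^ m) * (b - ?R) \<le> 2 * card F" for m
  proof -
    define N where "N = k * 2 ^ m"
    have N: "0 < N"
      using k by (simp add: N_def)
    obtain a where a: "a ` {..<N} \<subseteq> insert 0 ((\<lambda>C. (f C /\<^sub>R l C, h C / l C)) ` F)"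
      "norm (\<Sum>j<N. fst (a j)) \<le> card F"
      "real N * (\<Sum>C\<in>F. h C) - card F \<le> (\<Sum>j<N. snd (a j))"
      using round_convex_combination[OF F(1) f0 f l hl] by blast
    \<comment> \<open>This property concerns single terms and so passes to any selection. The
      padding zeros satisfy it with an arbitrary member of \<open>F\<close>.\<close>
    have aP: "norm (fst z) \<le> 1 \<and> (\<exists>C\<in>F. \<forall>y\<in>C. snd z \<le> fst z y)" if z: "z \<in> a ` {..<N}" for z
    proof -
      consider "z = 0" | C where "C \<in> F" "z = (f C /\<^sub>R l C, h C / l C)"
        using z a(1) by blast
      then show ?thesis
      proof cases
        case 1
        then show ?thesis
          using \<open>F \<noteq> {}\<close> by auto
      next
        case 2
        have "0 \<le> l C"
          using f[OF 2(1)] norm_ge_zero order_trans by blast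
        then show ?thesis
          using 2 f[OF 2(1)] h[OF 2(1)]
          by (auto simp: divide_simps blinfun.scaleR_left intro!: bexI[of _ C])
      qed
    qed
    obtain c where c: "c ` {..<k} \<subseteq> a ` {..<N}"
      "norm ((\<Sum>i<k. fst (c i)) /\<^sub>R k - (\<Sum>i<N. fst (a i)) /\<^sub>R N)
        \<le> (\<Sum>j<m. I * real (k * 2 ^ j) powr (-1 + 1 / p))"
      "(\<Sum>i<N. snd (a i)) / N \<le> (\<Sum>i<k. snd (c i)) / k"
    proof (rule select_subsequence[OF I, of k m a])
      show "norm (fst (a i)) \<le> 1" if "i < k * 2 ^ m" for i
        using aP[of "a i"] that by (simp add: N_def)
    qed (use p k that in \<open>auto simp: N_def\<close>)
    note c(2)
    \<comment> \<open>The halving errors are bounded independently of \<open>m\<close>.\<close>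
    also have "(\<Sum>j<m. I * real (k * 2 ^ j) powr (-1 + 1 / p)) \<le> ?R"
      using p k I by (intro sum_geometric_powr_le) (auto simp: infratype_bound_def)
    finally have "norm ((\<Sum>i<k. fst (c i)) /\<^sub>R k) \<le> ?R + norm ((\<Sum>i<N. fst (a i)) /\<^sub>R N)"
      using norm_triangle_sub[of "(\<Sum>i<k. fst (c i)) /\<^sub>R k" "(\<Sum>i<N. fst (a i)) /\<^sub>R N"] by linarith
    moreover have "norm ((\<Sum>i<N. fst (a i)) /\<^sub>R N) \<le> card F / N"
      using a(2) by (simp add: divide_simps)
    \<comment> \<open>The \<open>k\<close> selected terms involve at most \<open>k\<close> distinct
      members, which share a point \<open>y\<close> of the unit ball. Evaluating the mean functional
      at \<open>y\<close> compares its norm with the mean of the lower bounds.\<close>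
    moreover have "(\<Sum>i<k. snd (c i)) / k \<le> norm ((\<Sum>i<k. fst (c i)) /\<^sub>R k)"
    proof -
      have "\<exists>C. C \<in> F \<and> (\<forall>y\<in>C. snd (c i) \<le> fst (c i) y)" if "i < k" for i
        using aP[of "c i"] c(1) that by blast
      then obtain C where C: "\<And>i. i < k \<Longrightarrow> C i \<in> F" "\<And>i y. i < k \<Longrightarrow> y \<in> C i \<Longrightarrow> snd (c i) \<le> fst (c i) y"
        by metis
      have "\<Inter>(C ` {..<k}) \<noteq> {}"
        using C(1) card_image_le[of "{..<k}" C] by (intro inter) auto
      then obtain y where y: "\<And>i. i < k \<Longrightarrow> y \<in> C i"
        by auto
      have "norm y \<le> 1"
        using y[of 0] C(1)[of 0] F(3)[of "C 0"] k by auto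
      have "(\<Sum>i<k. snd (c i)) \<le> (\<Sum>i<k. fst (c i)) y"
        using C(2) y by (auto simp: blinfun.sum_left intro!: sum_mono)
      also have "\<dots> \<le> norm (\<Sum>i<k. fst (c i))"
        by (rule apply_le) fact
      finally show ?thesis
        by (simp add: divide_right_mono divide_inverse_commute mult_left_mono)
    qed
    ultimately have "(\<Sum>i<N. snd (a i)) / N \<le> ?R + card F / N"
      using c(3) by linarith
    moreover have "(N * b - card F) / N \<le> (\<Sum>i<N. snd (a i)) / N"
      using a(3) mult_left_mono[OF b, of "real N"] by (intro divide_right_mono) auto
    moreover define r where "r = ?R"
    ultimately have "(N * b - card F) / N \<le> r + card F / N"
      by simp
    then have "N * ((N * b - card F) / N) \<le> N * (r + card F / N)"
      using N by (intro mult_left_mono) auto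
    moreover have "N * ((N * b - card F) / N) = N * b - card F"
      using N by simp
    moreover have "N * (r + card F / N) = N * r + card F"
      using N by (simp add: distrib_left)
    ultimately have "N * b - N * r \<le> 2 * card F"
      by linarith
    then show ?thesis
      unfolding N_def[symmetric] r_def right_diff_distrib .
  qed
  show ?thesis
  proof (rule ccontr)
    assume "\<not> b \<le> ?R"
    then have pos: "0 < b - ?R"
      by simp
    obtain m where "2 * card F / (b - ?R) < 2 ^ m"
      using real_arch_pow[of 2 "2 * card F / (b - ?R)"] by auto
    then have "2 * card F < 2 ^ m * (b - ?R)"
      using pos by (simp add: pos_divide_less_eq)
    also have "\<dots> \<le> real (k * 2 ^ m) * (b - ?R)"
      using k pos by (intro mult_right_mono) auto
    finally show False
      using R[of m] by simp
  qed
qed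

section \<open>Passage to the Helly constant\<close>

theorem theorem1p5:
  fixes p :: real and k :: nat
  assumes "has_infratype TYPE('a::banach \<Rightarrow>\<^sub>L real) p"
    and "p > 1"
    and "k \<ge> 1"
  shows "helly TYPE('a) k
    \<le> 3 / (1 - 2 powr (-1 + 1 / p)) * infratype_const TYPE('a \<Rightarrow>\<^sub>L real) p
        * real k powr (-1 + 1 / p)"
proof -
  define I where "I = infratype_const TYPE('a \<Rightarrow>\<^sub>L real) p"
  define R where "R = I * real k powr (-1 + 1 / p) / (1 - 2 powr (-1 + 1 / p))"
  have I: "infratype_bound TYPE('a \<Rightarrow>\<^sub>L real) p I"
    unfolding I_def by (rule infratype_bound_infratype_const) fact
  have "2 powr (-1 + 1 / p) < 1"
    using \<open>p > 1\<close> by (intro powr_less_one) auto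
  then have R0: "0 \<le> R"
    using I by (auto simp: R_def infratype_bound_def)
  \<comment> \<open>If \<open>b\<close> is not admissible then \<open>b \<le> R\<close>, a
    contradiction only for \<open>b\<close> strictly above \<open>R\<close>; hence the bound is
    obtained by density.\<close>
  have "helly TYPE('a) k \<le> R"
  proof (rule dense_ge)
    fix b assume b: "R < b"
    have "helly_admissible TYPE('a) k b"
      unfolding helly_admissible_def
    proof (intro allI impI)
      fix F :: "'a set set"
      assume F: "finite F" "\<forall>C\<in>F. convex C \<and> C \<subseteq> cball 0 1"
        and inter: "\<forall>G. G \<subseteq> F \<and> card G \<le> k \<longrightarrow> \<Inter>G \<noteq> {}"
      show "\<exists>x. \<forall>C\<in>F. infdist x C \<le> b"
      proof (rule ccontr)
        assume neg: "\<not> (\<exists>x. \<forall>C\<in>F. infdist x C \<le> b)"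
        have "\<exists>C\<in>F. \<forall>y\<in>C. b \<le> norm (y - x)" for x
        proof -
          obtain C where "C \<in> F" "b < infdist x C"
            using neg by (meson not_le_imp_less)
          moreover have "infdist x C \<le> norm (y - x)" if "y \<in> C" for y
            using infdist_le[OF that, of x] by (simp add: dist_norm norm_minus_commute)
          ultimately show ?thesis
            by (intro bexI[of _ C]) force+
        qed
        then have "b \<le> R"
          unfolding R_def using F inter assms
          by (intro far_from_family_bound[OF I, where F = F]) auto
        with b show False
          by simp
      qed
    qed
    then show "helly TYPE('a) k \<le> b"
      unfolding helly_def using R0 b by (intro cInf_lower) (auto intro: bdd_belowI[of _ 0])
  qed
  \<comment> \<open>The argument gives the estimate with factor \<open>1\<close>, which implies the
    stated one since \<open>R\<close> is non-negative.\<close>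
  also have "R \<le> 3 * R"
    using R0 by simp
  finally show ?thesis
    by (simp add: R_def I_def)
qed

end
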